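(* Let $X$ be an $\mathbf{r}$-exterior flow. Then: (i) $\omega^{\mathbf{r}}(p)\subset \bar L_{\bar\omega_{\mathbf{r}}(p)}(X)$ for every $p\in X$. (ii) If $a\in\check{\bar c}(X)$ is $\bar\omega_{\mathbf{r}}$-representable (that is, $\bar X_{(\mathbf{r},a)}=\bar\omega_{\mathbf{r}}^{-1}(a)\neq\emptyset$) and there exists $p\in\bar X_{(\mathbf{r},a)}$ such that $\omega^{\mathbf{r}}(p)\neq\emptyset$, then $a$ is $\bar e$-representable, i.e. there is $q\in\bar L(X)$ with $\bar e(q)=a$.
   Context: An externology on a topological space $X$ is a non-empty collection $\varepsilon(X)$ of open subsets closed under finite intersections and such that any open set containing a member of $\varepsilon(X)$ is in $\varepsilon(X)$. An exterior space is a topological space with an externology. A flow on $X$ is a continuous action $\varphi:\mathbb{R}\times X\to X$, $\varphi(t,x)=t\cdot x$, of the group $\mathbb{R}$. An $\mathbf{r}$-exterior flow is an exterior space $(X,\varepsilon(X))$ with a flow such that (a) for every $E\in\varepsilon(X)$ and $x\in X$ there is $r_0\in\mathbb{R}$ with $r\cdot x\in E$ for all $r\ge r_0$; and (b) for every $t\in\mathbb{R}$ and $E\in\varepsilon(X)$ there is $G\in\varepsilon(X)$ with $(ts)\cdot x\in E$ for all $s\in[0,1]$, $x\in G$. For $p\in X$, $\omega^{\mathbf{r}}(p)=\bigcap_{t\ge0}\overline{[t,+\infty)\cdot p}$. Define $\bar L(X)=\bigcap_{E\in\varepsilon(X)}\overline{E}$ and $\check{\bar c}(X)=\lim_{E\in\varepsilon(X)}c(\overline{E})$,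 where $c(Y)$ is the set of connected components of $Y$ with the quotient topology and the inverse limit is over inclusions. The map $\bar e:\bar L(X)\to\check{\bar c}(X)$ sends $q$ to the family of components of the $\overline{E}$'s containing $q$; for $a\in\check{\bar c}(X)$ put $\bar L_a(X)=\bar e^{-1}(a)$. The set map $\bar\omega_{\mathbf{r}}:X\to\check{\bar c}(X)$ sends $p$ to the family $(\bar\omega_{\mathbf{r}}(p,\overline{E}))_{E}$, where $\bar\omega_{\mathbf{r}}(p,\overline{E})$ is the unique connected component of $\overline{E}$ containing $(n,+\infty)\cdot p$ for all sufficiently large $n$. *)

theory Defs
  imports "HOL-Analysis.Analysis"
begin

locale exterior_space =
  fixes X :: "'a topology" and \<epsilon> :: "'a set set"
  assumes ext_nonempty: "\<epsilon> \<noteq> {}"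
    and ext_open: "E \<in> \<epsilon> \<Longrightarrow> openin X E"
    and ext_Int: "E \<in> \<epsilon> \<Longrightarrow> G \<in> \<epsilon> \<Longrightarrow> E \<inter> G \<in> \<epsilon>"
    and ext_upward: "E \<in> \<epsilon> \<Longrightarrow> openin X U \<Longrightarrow> E \<subseteq> U \<Longrightarrow> U \<in> \<epsilon>"

locale flow =
  fixes X :: "'a topology" and \<phi> :: "real \<Rightarrow> 'a \<Rightarrow> 'a"
  assumes flow_continuous:
      "continuous_map (prod_topology euclideanreal X) X (\<lambda>(t, x). \<phi> t x)"
    and flow_zero: "x \<in> topspace X \<Longrightarrow> \<phi> 0 x = x"
    and flow_add: "x \<in> topspace X \<Longrightarrow> \<phi> (s + t) x = \<phi> s (\<phi> t x)"

locale r_exterior_flow = exterior_space X \<epsilon> + flow X \<phi>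
  for X :: "'a topology" and \<epsilon> :: "'a set set" and \<phi> :: "real \<Rightarrow> 'a \<Rightarrow> 'a" +
  assumes absorbing:
      "E \<in> \<epsilon> \<Longrightarrow> x \<in> topspace X \<Longrightarrow> \<exists>r0. \<forall>r\<ge>r0. \<phi> r x \<in> E"
    and ext_homotopy:
      "E \<in> \<epsilon> \<Longrightarrow> \<exists>G\<in>\<epsilon>. \<forall>s\<in>{0..1}. \<forall>x\<in>G. \<phi> (t * s) x \<in> E"

definition omega_limit :: "'a topology \<Rightarrow> (real \<Rightarrow> 'a \<Rightarrow> 'a) \<Rightarrow> 'a \<Rightarrow> 'a set" where
  "omega_limit X \<phi> p = (\<Inter>t\<in>{0..}. X closure_of ((\<lambda>s. \<phi> s p) ` {t..}))"

text \<open>The quotient topology on the set of components: the preimage in \<open>Y\<close> of a set \<open>U\<close> of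
  components is \<open>\<Union>U\<close>.\<close>

definition component_space :: "'a topology \<Rightarrow> 'a set topology" where
  "component_space Y = topology (\<lambda>U. U \<subseteq> connected_components_of Y \<and> openin Y (\<Union>U))"

lemma openin_component_space:
  "openin (component_space Y) U \<longleftrightarrow> U \<subseteq> connected_components_of Y \<and> openin Y (\<Union>U)"
proof -
  have disj: "C = D" if "C \<in> connected_components_of Y" "D \<in> connected_components_of Y"
    "x \<in> C" "x \<in> D" for C D x
    using that pairwise_disjoint_connected_components_of[of Y]
    by (auto simp: pairwise_def disjnt_def)
  have "istopology (\<lambda>U. U \<subseteq> connected_components_of Y \<and> openin Y (\<Union>U))"
    unfolding istopology_def
  proof (intro conjI allI impI)
    fix S T
    assume S: "S \<subseteq> connected_components_of Y \<and> openin Y (\<Union>S)"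
      and T: "T \<subseteq> connected_components_of Y \<and> openin Y (\<Union>T)"
    have "\<Union>(S \<inter> T) = \<Union>S \<inter> \<Union>T"
      using S T disj by blast
    then show "openin Y (\<Union>(S \<inter> T))"
      using S T by auto
    show "S \<inter> T \<subseteq> connected_components_of Y"
      using S by auto
  next
    fix K
    assume K: "\<forall>U\<in>K. U \<subseteq> connected_components_of Y \<and> openin Y (\<Union>U)"
    have "\<Union>(\<Union>K) = (\<Union>U\<in>K. \<Union>U)"
      by auto
    then show "openin Y (\<Union>(\<Union>K))"
      using K by auto
    show "\<Union>K \<subseteq> connected_components_of Y"
      using K by auto
  qed
  then show ?thesis
    by (simp add: component_space_def)
qed

lemma topspace_component_space [simp]:
  "topspace (component_space Y) = connected_components_of Y"
proof -
  have "openin (component_space Y) (connected_components_of Y)"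
    by (simp add: openin_component_space Union_connected_components_of)
  then show ?thesis
    by (metis openin_component_space openin_subset openin_topspace subset_antisym)
qed

text \<open>The map on components induced by an inclusion into \<open>Z\<close>; used only for \<open>C\<close> connected and
  nonempty in \<open>Z\<close>, where the component containing it exists and is unique.\<close>

definition component_map :: "'a topology \<Rightarrow> 'a set \<Rightarrow> 'a set" where
  "component_map Z C = (THE D. D \<in> connected_components_of Z \<and> C \<subseteq> D)"

abbreviation closure_space :: "'a topology \<Rightarrow> 'a set \<Rightarrow> 'a topology" where
  "closure_space X E \<equiv> subtopology X (X closure_of E)"

text \<open>The inverse limit over the externology, directed by inclusion, as a subspace of the product;
  its points are compatible families that are \<open>undefined\<close> outside \<open>\<epsilon>\<close>.\<close>

definition end_space :: "'a topology \<Rightarrow> 'a set set \<Rightarrow> ('a set \<Rightarrow> 'a set) topology" where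
  "end_space X \<epsilon> =
     subtopology (product_topology (\<lambda>E. component_space (closure_space X E)) \<epsilon>)
       {a. \<forall>E\<in>\<epsilon>. \<forall>G\<in>\<epsilon>. G \<subseteq> E \<longrightarrow> component_map (closure_space X E) (a G) = a E}"

lemma component_map_eqI:
  assumes "D \<in> connected_components_of Z" "C \<subseteq> D" "C \<noteq> {}"
  shows "component_map Z C = D"
  unfolding component_map_def
proof (rule the_equality)
  fix D'
  assume "D' \<in> connected_components_of Z \<and> C \<subseteq> D'"
  then show "D' = D"
    using assms connected_components_of_overlap[of D Z D'] by blast
qed (use assms in auto)

lemma topspace_end_space_iff:
  "a \<in> topspace (end_space X \<epsilon>) \<longleftrightarrow>
     a \<in> (\<Pi>\<^sub>E E\<in>\<epsilon>. connected_components_of (closure_space X E)) \<and>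
     (\<forall>E\<in>\<epsilon>. \<forall>G\<in>\<epsilon>. G \<subseteq> E \<longrightarrow> a G \<subseteq> a E)"
proof -
  have "component_map (closure_space X E) (a G) = a E \<longleftrightarrow> a G \<subseteq> a E"
    if a: "a \<in> (\<Pi>\<^sub>E E\<in>\<epsilon>. connected_components_of (closure_space X E))"
      and E: "E \<in> \<epsilon>" and G: "G \<in> \<epsilon>" and "G \<subseteq> E" for E G
  proof -
    have aE: "a E \<in> connected_components_of (closure_space X E)"
      and aG: "a G \<in> connected_components_of (closure_space X G)"
      using a E G by auto
    have ne: "a G \<noteq> {}"
      using aG nonempty_connected_components_of by blast
    have con: "connectedin (closure_space X E) (a G)"
    proof -
      have "connectedin X (a G)" "a G \<subseteq> X closure_of G"
        using connectedin_connected_components_of[OF aG]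
        by (auto simp: connectedin_subtopology)
      then show ?thesis
        using closure_of_mono[OF \<open>G \<subseteq> E\<close>] by (auto simp: connectedin_subtopology)
    qed
    obtain x where x: "x \<in> a G"
      using ne by blast
    define D where "D = connected_component_of_set (closure_space X E) x"
    have sub: "a G \<subseteq> D"
      unfolding D_def using con x by (rule connected_component_of_maximal)
    have D: "D \<in> connected_components_of (closure_space X E)"
      unfolding D_def connected_component_in_connected_components_of
      using con x connectedin_subset_topspace by blast
    show ?thesis
      using component_map_eqI[OF D sub ne] component_map_eqI[OF aE _ ne] sub by metis
  qed
  then have "(\<forall>E\<in>\<epsilon>. \<forall>G\<in>\<epsilon>. G \<subseteq> E \<longrightarrow> component_map (closure_space X E) (a G) = a E)
      \<longleftrightarrow> (\<forall>E\<in>\<epsilon>. \<forall>G\<in>\<epsilon>. G \<subseteq> E \<longrightarrow> a G \<subseteq> a E)"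
    if "a \<in> (\<Pi>\<^sub>E E\<in>\<epsilon>. connected_components_of (closure_space X E))"
    using that by meson
  then show ?thesis
    by (simp add: end_space_def comp_def cong: conj_cong)
qed

definition limit_space :: "'a topology \<Rightarrow> 'a set set \<Rightarrow> 'a set" where
  "limit_space X \<epsilon> = (\<Inter>E\<in>\<epsilon>. X closure_of E)"

definition end_map :: "'a topology \<Rightarrow> 'a set set \<Rightarrow> 'a \<Rightarrow> 'a set \<Rightarrow> 'a set" where
  "end_map X \<epsilon> q = (\<lambda>E\<in>\<epsilon>. connected_component_of_set (closure_space X E) q)"

definition limit_space_at ::
  "'a topology \<Rightarrow> 'a set set \<Rightarrow> ('a set \<Rightarrow> 'a set) \<Rightarrow> 'a set" where
  "limit_space_at X \<epsilon> a = {q \<in> limit_space X \<epsilon>. end_map X \<epsilon> q = a}"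

definition omega_component ::
  "'a topology \<Rightarrow> (real \<Rightarrow> 'a \<Rightarrow> 'a) \<Rightarrow> 'a \<Rightarrow> 'a set \<Rightarrow> 'a set" where
  "omega_component X \<phi> p Y =
     (THE C. C \<in> connected_components_of (subtopology X Y) \<and>
        (\<exists>N::nat. \<forall>n\<ge>N. (\<lambda>s. \<phi> s p) ` {real n<..} \<subseteq> C))"

definition omega_map ::
  "'a topology \<Rightarrow> 'a set set \<Rightarrow> (real \<Rightarrow> 'a \<Rightarrow> 'a) \<Rightarrow> 'a \<Rightarrow> 'a set \<Rightarrow> 'a set" where
  "omega_map X \<epsilon> \<phi> p = (\<lambda>E\<in>\<epsilon>. omega_component X \<phi> p (X closure_of E))"

definition basin ::
  "'a topology \<Rightarrow> 'a set set \<Rightarrow> (real \<Rightarrow> 'a \<Rightarrow> 'a) \<Rightarrow> ('a set \<Rightarrow> 'a set) \<Rightarrow> 'a set" where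
  "basin X \<epsilon> \<phi> a = {p \<in> topspace X. omega_map X \<epsilon> \<phi> p = a}"

definition omega_representable ::
  "'a topology \<Rightarrow> 'a set set \<Rightarrow> (real \<Rightarrow> 'a \<Rightarrow> 'a) \<Rightarrow> ('a set \<Rightarrow> 'a set) \<Rightarrow> bool" where
  "omega_representable X \<epsilon> \<phi> a \<longleftrightarrow> basin X \<epsilon> \<phi> a \<noteq> {}"

definition end_representable ::
  "'a topology \<Rightarrow> 'a set set \<Rightarrow> ('a set \<Rightarrow> 'a set) \<Rightarrow> bool" where
  "end_representable X \<epsilon> a \<longleftrightarrow> (\<exists>q \<in> limit_space X \<epsilon>. end_map X \<epsilon> q = a)"

lemma end_map_in_end_space:
  assumes "q \<in> limit_space X \<epsilon>"
  shows "end_map X \<epsilon> q \<in> topspace (end_space X \<epsilon>)"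
proof -
  have q: "q \<in> topspace (closure_space X E)" if "E \<in> \<epsilon>" for E
    using assms that closure_of_subset_topspace[of X E] by (auto simp: limit_space_def)
  have "end_map X \<epsilon> q \<in> (\<Pi>\<^sub>E E\<in>\<epsilon>. connected_components_of (closure_space X E))"
    using q by (auto simp: end_map_def connected_component_in_connected_components_of)
  moreover have "connected_component_of_set (closure_space X G) q
      \<subseteq> connected_component_of_set (closure_space X E) q" if "G \<subseteq> E" for E G
    using connected_component_of_mono[OF _ closure_of_mono[OF that]] by blast
  ultimately show ?thesis
    unfolding topspace_end_space_iff by (simp add: end_map_def)
qed

context r_exterior_flow
begin

lemma omega_component_props:
  assumes E: "E \<in> \<epsilon>" and p: "p \<in> topspace X"
  shows "omega_component X \<phi> p (X closure_of E) \<in> connected_components_of (closure_space X E)"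
    and "\<exists>N::nat. \<forall>n\<ge>N. (\<lambda>s. \<phi> s p) ` {real n<..} \<subseteq> omega_component X \<phi> p (X closure_of E)"
proof -
  let ?Z = "closure_space X E"
  let ?o = "\<lambda>n::nat. (\<lambda>s. \<phi> s p) ` {real n<..}"
  let ?P = "\<lambda>C. C \<in> connected_components_of ?Z \<and> (\<exists>N. \<forall>n\<ge>N. ?o n \<subseteq> C)"
  obtain r0 where r0: "\<And>r. r \<ge> r0 \<Longrightarrow> \<phi> r p \<in> E"
    using absorbing[OF E p] by blast
  obtain N :: nat where N: "real N \<ge> r0"
    using real_arch_simple by blast
  have "continuous_map euclideanreal (prod_topology euclideanreal X) (\<lambda>t. (t, p))"
    using p by (simp add: continuous_map_pairwise comp_def)
  from continuous_map_compose[OF this flow_continuous]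
  have cont: "continuous_map euclideanreal X (\<lambda>s. \<phi> s p)"
    by (simp add: comp_def)
  have "connectedin X (?o N)"
    by (rule connectedin_continuous_map_image[OF cont]) simp
  moreover have "?o N \<subseteq> X closure_of E"
    using r0 N closure_of_subset[OF openin_subset[OF ext_open[OF E]]] by fastforce
  ultimately have con: "connectedin ?Z (?o N)"
    by (simp add: connectedin_subtopology)
  define x where "x = \<phi> (real N + 1) p"
  have x: "x \<in> ?o N"
    by (auto simp: x_def)
  define D where "D = connected_component_of_set ?Z x"
  have D: "D \<in> connected_components_of ?Z"
    unfolding D_def connected_component_in_connected_components_of
    using con x connectedin_subset_topspace by blast
  have "?o N \<subseteq> D"
    unfolding D_def using con x by (rule connected_component_of_maximal)
  then have "\<forall>n\<ge>N. ?o n \<subseteq> D"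
    by fastforce
  with D have PD: "?P D"
    by blast
  have uniq: "C = D" if "?P C" "?P D" for C D
  proof -
    obtain N1 N2 where "\<forall>n\<ge>N1. ?o n \<subseteq> C" "\<forall>n\<ge>N2. ?o n \<subseteq> D"
      using \<open>?P C\<close> \<open>?P D\<close> by blast
    then have "?o (max N1 N2) \<subseteq> C \<inter> D"
      by simp
    moreover have "?o (max N1 N2) \<noteq> {}"
      by simp
    ultimately have "C \<inter> D \<noteq> {}"
      by blast
    then show ?thesis
      using connected_components_of_overlap[of C ?Z D] \<open>?P C\<close> \<open>?P D\<close> by blast
  qed
  have "\<exists>!C. ?P C"
    by (rule ex1I[of ?P D]) (rule PD, rule uniq, assumption, rule PD)
  from theI'[OF this]
  show "omega_component X \<phi> p (X closure_of E) \<in> connected_components_of ?Z"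
    and "\<exists>N::nat. \<forall>n\<ge>N. ?o n \<subseteq> omega_component X \<phi> p (X closure_of E)"
    unfolding omega_component_def by blast+
qed

lemma omega_map_in_end_space:
  assumes p: "p \<in> topspace X"
  shows "omega_map X \<epsilon> \<phi> p \<in> topspace (end_space X \<epsilon>)"
proof -
  let ?w = "\<lambda>E. omega_component X \<phi> p (X closure_of E)"
  let ?o = "\<lambda>n::nat. (\<lambda>s. \<phi> s p) ` {real n<..}"
  have "?w G \<subseteq> ?w E" if E: "E \<in> \<epsilon>" and G: "G \<in> \<epsilon>" and "G \<subseteq> E" for E G
  proof -
    obtain N1 N2 where "\<forall>n\<ge>N1. ?o n \<subseteq> ?w E" "\<forall>n\<ge>N2. ?o n \<subseteq> ?w G"
      using omega_component_props(2)[OF E p] omega_component_props(2)[OF G p] by blast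
    then have "?o (max N1 N2) \<subseteq> ?w E \<inter> ?w G"
      by simp
    moreover have "?o (max N1 N2) \<noteq> {}"
      by simp
    ultimately have meet: "\<not> disjnt (?w E) (?w G)"
      unfolding disjnt_def by blast
    have "connectedin X (?w G)" "?w G \<subseteq> X closure_of G"
      using connectedin_connected_components_of[OF omega_component_props(1)[OF G p]]
      by (auto simp: connectedin_subtopology)
    then have "connectedin (closure_space X E) (?w G)"
      using closure_of_mono[OF \<open>G \<subseteq> E\<close>] by (auto simp: connectedin_subtopology)
    then show ?thesis
      using connected_components_of_maximal[OF omega_component_props(1)[OF E p]] meet by blast
  qed
  then show ?thesis
    unfolding topspace_end_space_iff omega_map_def
    using omega_component_props(1)[OF _ p] by auto
qed

end

end

theory Submission
  imports Defs
begin

text \<open>For each E in \<epsilon>, a tail of the orbit of p lies in a single component of the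
  closure of E. That component is closed in the closure of E, hence in X, so it also contains the
  closure of the tail and with it the whole omega-limit of p
  (\<open>omega_limit_subset_omega_component\<close>). A point q of the omega-limit thus lies, for
  every E, in the component selected by the orbit, so q and p determine the same end. Any point of a
  nonempty omega-limit therefore represents the end of p.\<close>

lemma closedin_connected_components_of_closure_space:
  assumes "C \<in> connected_components_of (closure_space X E)"
  shows "closedin X C"
  using closedin_trans_full[OF closedin_connected_components_of[OF assms] closedin_closure_of] .

context r_exterior_flow
begin

text \<open>A component of a closed set is closed, so it contains the limit points of any tail of an
  orbit that lies in it.\<close>

lemma omega_limit_subset_omega_component:
  assumes E: "E \<in> \<epsilon>" and p: "p \<in> topspace X"
  shows "omega_limit X \<phi> p \<subseteq> omega_component X \<phi> p (X closure_of E)"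
proof -
  let ?C = "omega_component X \<phi> p (X closure_of E)"
  obtain N :: nat where "(\<lambda>s. \<phi> s p) ` {real N<..} \<subseteq> ?C"
    using omega_component_props(2)[OF E p] by blast
  \<comment> \<open>Components are tested on open rays, \<open>omega_limit\<close> on closed ones:
    the closed ray from N + 1 fits inside the open ray from N, and its start is nonnegative, as the
    intersection requires.\<close>
  then have "(\<lambda>s. \<phi> s p) ` {real N + 1..} \<subseteq> ?C"
    by (force simp: image_subset_iff)
  then have "X closure_of ((\<lambda>s. \<phi> s p) ` {real N + 1..}) \<subseteq> ?C"
    using closedin_connected_components_of_closure_space[OF omega_component_props(1)[OF E p]]
    by (rule closure_of_minimal)
  moreover have "omega_limit X \<phi> p \<subseteq> X closure_of ((\<lambda>s. \<phi> s p) ` {real N + 1..})"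
    unfolding omega_limit_def by (rule INF_lower) simp
  ultimately show ?thesis
    by blast
qed

lemma omega_limit_subset_limit_space_at:
  assumes p: "p \<in> topspace X"
  shows "omega_limit X \<phi> p \<subseteq> limit_space_at X \<epsilon> (omega_map X \<epsilon> \<phi> p)"
proof
  fix q
  assume q: "q \<in> omega_limit X \<phi> p"
  let ?w = "\<lambda>E. omega_component X \<phi> p (X closure_of E)"
  have qw: "q \<in> ?w E" if "E \<in> \<epsilon>" for E
    using omega_limit_subset_omega_component[OF that p] q by blast
  have "q \<in> X closure_of E" if "E \<in> \<epsilon>" for E
    using qw[OF that] connected_components_of_subset[OF omega_component_props(1)[OF that p]]
    by auto
  \<comment> \<open>Components are equivalence classes, so the one that contains q is the class of
    q.\<close>
  moreover have "connected_component_of_set (closure_space X E) q = ?w E" if "E \<in> \<epsilon>" for E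
    using qw[OF that] omega_component_props(1)[OF that p]
    by (auto simp: connected_components_of_def connected_component_of_equiv)
  \<comment> \<open>Both families are restricted to \<epsilon>, so agreement on \<epsilon> makes
    them equal as functions.\<close>
  ultimately show "q \<in> limit_space_at X \<epsilon> (omega_map X \<epsilon> \<phi> p)"
    by (simp add: limit_space_at_def limit_space_def end_map_def omega_map_def cong: restrict_cong)
qed

end

theorem proposition4p8:
  fixes X :: "'a topology" and \<epsilon> :: "'a set set" and \<phi> :: "real \<Rightarrow> 'a \<Rightarrow> 'a"
  assumes "r_exterior_flow X \<epsilon> \<phi>"
  shows "(\<forall>p \<in> topspace X. omega_limit X \<phi> p \<subseteq> limit_space_at X \<epsilon> (omega_map X \<epsilon> \<phi> p)) \<and>
    (\<forall>a \<in> topspace (end_space X \<epsilon>).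
       omega_representable X \<epsilon> \<phi> a \<and> (\<exists>p \<in> basin X \<epsilon> \<phi> a. omega_limit X \<phi> p \<noteq> {})
         \<longrightarrow> end_representable X \<epsilon> a)"
proof -
  have limit: "\<forall>p \<in> topspace X. omega_limit X \<phi> p \<subseteq> limit_space_at X \<epsilon> (omega_map X \<epsilon> \<phi> p)"
    using r_exterior_flow.omega_limit_subset_limit_space_at[OF assms] by blast
  \<comment> \<open>For p in the basin of a, any q in its omega-limit has
    \<open>end_map X \<epsilon> q = omega_map X \<epsilon> \<phi> p = a\<close>.\<close>
  then show ?thesis
    by (fastforce simp: basin_def limit_space_at_def end_representable_def)
qed

end
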